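(* Let $r,d\geq1$ and $x,y\in F(X_r)$. Then $x$ and $y$ represent conjugate elements of the free solvable group $S_{r,d}$ if and only if there exists $z\in F(X_r)$ such that $\pi_{zxz^{-1}}\equiv\pi_y$ in $\mathrm{Sch}_{d-1}(y)$, i.e. $zxz^{-1}$ and $y$ define the same flow on the Schreier graph of $\langle y\rangle$ in $S_{r,d-1}$. Moreover, $z$ can be viewed as an element of $S_{r,d-1}$ (that is, the condition on $z$ depends only on the image of $z$ in $S_{r,d-1}$).
   Context: $F=F(X_r)$ is the free group with basis $X_r=\{x_1,\dots,x_r\}$, $F^{(0)}=F$, $F^{(i)}=[F^{(i-1)},F^{(i-1)}]$, and $S_{r,i}=F/F^{(i)}$ (so $S_{r,0}$ is trivial). Schreier graph: for a subgroup $H$ of a group $G$ generated by $X_r$, the Schreier graph has vertex set $\{Hg\mid g\in G\}$ and labeled directed edges $Hg\stackrel{x}{\rightarrow}Hgx$ for $g\in G$, $x\in X_r^{\pm}$, with root $H$; the inverse of the edge $Hg\stackrel{x}{\rightarrow}Hgx$ is $Hgx\stackrel{x^{-1}}{\rightarrow}Hg$. The edges labeled by elements of $X_r$ are taken as positive edges. $\mathrm{Sch}_i(y)$ denotes the Schreier graph of the cyclic subgroup $\langle y\rangle$ generated by the image of $y$ in $S_{r,i}$. Flow of a word: for $w\in F(X_r)$, let $p_w$ be the unique path starting at the root and labeled by $w$. The flow $\pi_w$ is the integer-valued function on positive edges whose value on $e$ is the number of times $p_w$ traverses $e$ minus the number of times it traverses $e^{-1}$. *)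

theory Defs
  imports "HOL-Algebra.Generated_Groups" "Graph_Theory.Arc_Walk"
begin

section \<open>The free group on a finite set of generators\<close>

text \<open>
  The letter \<open>(j, True)\<close> is the basis element $x_{j+1}$ and \<open>(j, False)\<close> is its inverse.
  Elements of the free group are the freely reduced words; two of them are multiplied by
  concatenation followed by free reduction.
\<close>

type_synonym letter = "nat \<times> bool"
type_synonym word = "letter list"

definition inv_letter :: "letter \<Rightarrow> letter" where
  "inv_letter a = (fst a, \<not> snd a)"

definition letters :: "nat \<Rightarrow> letter set" where
  "letters r = {..<r} \<times> UNIV"

definition reduced :: "word \<Rightarrow> bool" where
  "reduced w \<longleftrightarrow> successively (\<lambda>a b. b \<noteq> inv_letter a) w"

fun cancel_Cons :: "letter \<Rightarrow> word \<Rightarrow> word" where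
  "cancel_Cons a [] = [a]"
| "cancel_Cons a (b # w) = (if b = inv_letter a then w else a # b # w)"

definition reduce :: "word \<Rightarrow> word" where
  "reduce w = foldr cancel_Cons w []"

definition free_group :: "nat \<Rightarrow> word monoid" where
  "free_group r = \<lparr>carrier = {w \<in> lists (letters r). reduced w},
     mult = (\<lambda>u v. reduce (u @ v)), one = []\<rparr>"

lemma inv_letter_inv_letter [simp]: "inv_letter (inv_letter a) = a"
  by (simp add: inv_letter_def)

lemma inv_letter_in_letters [simp]: "inv_letter a \<in> letters r \<longleftrightarrow> a \<in> letters r"
  by (cases a) (simp add: inv_letter_def letters_def)

lemma reduced_Nil [simp]: "reduced []"
  by (simp add: reduced_def)

lemma reduced_ConsD: "reduced (a # w) \<Longrightarrow> reduced w"
  by (cases w) (auto simp: reduced_def)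

lemma reduced_cancel_Cons: "reduced w \<Longrightarrow> reduced (cancel_Cons a w)"
  by (cases w) (auto simp: reduced_def dest: reduced_ConsD[unfolded reduced_def])

lemma cancel_Cons_letters:
  "w \<in> lists (letters r) \<Longrightarrow> a \<in> letters r \<Longrightarrow> cancel_Cons a w \<in> lists (letters r)"
  by (cases w) auto

lemma cancel_Cons_inverse:
  "reduced w \<Longrightarrow> cancel_Cons a (cancel_Cons (inv_letter a) w) = w"
  by (cases w rule: remdups_adj.cases) (auto simp: reduced_def)

lemma foldr_cancel_Cons_reduced: "reduced v \<Longrightarrow> reduced (foldr cancel_Cons u v)"
  by (induction u) (auto intro: reduced_cancel_Cons)

lemma foldr_cancel_Cons_letters:
  "u \<in> lists (letters r) \<Longrightarrow> v \<in> lists (letters r) \<Longrightarrow>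
    foldr cancel_Cons u v \<in> lists (letters r)"
  by (induction u) (simp_all add: cancel_Cons_letters del: in_lists_conv_set)

lemma reduce_reduced: "reduced w \<Longrightarrow> reduce w = w"
proof (induction w)
  case (Cons a w)
  then show ?case
    by (cases w) (auto simp: reduce_def reduced_def)
qed (simp add: reduce_def)

lemma reduce_append: "reduced v \<Longrightarrow> reduce (u @ v) = foldr cancel_Cons u v"
  using reduce_reduced[of v] by (simp add: reduce_def)

lemma foldr_cancel_Cons_cancel_Cons:
  assumes "reduced u" "reduced v"
  shows "foldr cancel_Cons (cancel_Cons a u) v = cancel_Cons a (foldr cancel_Cons u v)"
proof (cases u)
  case (Cons b w)
  have "cancel_Cons a (cancel_Cons (inv_letter a) (foldr cancel_Cons w v)) = foldr cancel_Cons w v"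
    by (rule cancel_Cons_inverse) (rule foldr_cancel_Cons_reduced[OF assms(2)])
  then show ?thesis using Cons by simp
qed simp

lemma foldr_cancel_Cons_assoc:
  assumes "reduced v" "reduced w"
  shows "foldr cancel_Cons (foldr cancel_Cons u v) w = foldr cancel_Cons u (foldr cancel_Cons v w)"
  by (induction u)
     (simp_all add: foldr_cancel_Cons_cancel_Cons foldr_cancel_Cons_reduced assms)

lemma foldr_cancel_Cons_rev_inverse:
  "reduced v \<Longrightarrow> foldr cancel_Cons (map inv_letter (rev u)) (foldr cancel_Cons u v) = v"
proof (induction u arbitrary: v)
  case (Cons a u)
  have "cancel_Cons (inv_letter a) (cancel_Cons a (foldr cancel_Cons u v)) = foldr cancel_Cons u v"
    using cancel_Cons_inverse[OF foldr_cancel_Cons_reduced[OF Cons.prems], of "inv_letter a"] by simp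
  then show ?case using Cons by simp
qed simp

theorem group_free_group: "group (free_group r)"
proof (rule groupI)
  fix u assume u: "u \<in> carrier (free_group r)"
  let ?v = "reduce (map inv_letter (rev u))"
  have "map inv_letter (rev u) \<in> lists (letters r)"
    using u by (auto simp only: free_group_def in_lists_conv_set set_map set_rev
      inv_letter_in_letters partial_object.simps mem_Collect_eq)
  then have "?v \<in> carrier (free_group r)"
    using foldr_cancel_Cons_letters[of "map inv_letter (rev u)" r "[]"]
    by (simp add: free_group_def reduce_def foldr_cancel_Cons_reduced del: in_lists_conv_set)
  moreover have "reduce (?v @ u) = []"
  proof -
    have ru: "reduced u" using u by (simp add: free_group_def)
    have "reduce (?v @ u) = foldr cancel_Cons (map inv_letter (rev u)) (foldr cancel_Cons u [])"
      using foldr_cancel_Cons_assoc[of "[]" u "map inv_letter (rev u)"] ru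
        reduce_reduced[OF ru] by (simp add: reduce_append) (simp add: reduce_def)
    then show ?thesis by (simp add: foldr_cancel_Cons_rev_inverse)
  qed
  ultimately show "\<exists>v\<in>carrier (free_group r). v \<otimes>\<^bsub>free_group r\<^esub> u = \<one>\<^bsub>free_group r\<^esub>"
    by (auto simp: free_group_def)
next
  fix u v w
  assume "u \<in> carrier (free_group r)" "v \<in> carrier (free_group r)" "w \<in> carrier (free_group r)"
  then show "u \<otimes>\<^bsub>free_group r\<^esub> v \<otimes>\<^bsub>free_group r\<^esub> w = u \<otimes>\<^bsub>free_group r\<^esub> (v \<otimes>\<^bsub>free_group r\<^esub> w)"
    by (simp add: free_group_def reduce_append foldr_cancel_Cons_reduced foldr_cancel_Cons_assoc)
qed (simp_all add: free_group_def reduce_append reduce_reduced foldr_cancel_Cons_reduced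
       foldr_cancel_Cons_letters del: in_lists_conv_set)


section \<open>Free solvable groups\<close>

definition derived_term :: "nat \<Rightarrow> nat \<Rightarrow> word set" where
  "derived_term r i = (derived (free_group r) ^^ i) (carrier (free_group r))"

definition free_solvable :: "nat \<Rightarrow> nat \<Rightarrow> word set monoid" where
  "free_solvable r i = free_group r Mod derived_term r i"

text \<open>The image of a word under the projection of the free group onto \<open>free_solvable r i\<close>.\<close>

definition proj :: "nat \<Rightarrow> nat \<Rightarrow> word \<Rightarrow> word set" where
  "proj r i w = derived_term r i #>\<^bsub>free_group r\<^esub> w"

definition conjugate_in :: "('a, 'b) monoid_scheme \<Rightarrow> 'a \<Rightarrow> 'a \<Rightarrow> bool" where
  "conjugate_in G a b \<longleftrightarrow> (\<exists>g\<in>carrier G. g \<otimes>\<^bsub>G\<^esub> a \<otimes>\<^bsub>G\<^esub> inv\<^bsub>G\<^esub> g = b)"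

lemma derived_term_normal: "derived_term r i \<lhd> free_group r"
  using group_free_group
  by (induction i) (simp_all add: derived_term_def group.normal_self group.derived_is_normal)

lemma group_free_solvable: "group (free_solvable r i)"
  unfolding free_solvable_def by (rule normal.factorgroup_is_group[OF derived_term_normal])

lemma proj_closed: "w \<in> carrier (free_group r) \<Longrightarrow> proj r i w \<in> carrier (free_solvable r i)"
  by (auto simp: proj_def free_solvable_def FactGroup_def RCOSETS_def)


section \<open>Schreier graphs and flows\<close>

text \<open>
  An edge is a triple consisting of its origin, its label and its terminus. The group \<open>G\<close> is
  meant to be generated by the images \<open>\<phi> j\<close>, \<open>j < r\<close>, of the basis elements. The root of the
  Schreier graph of \<open>H\<close> is the vertex \<open>H\<close>.
\<close>

type_synonym 'v edge = "'v \<times> letter \<times> 'v"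

definition letter_val :: "('a, 'b) monoid_scheme \<Rightarrow> (nat \<Rightarrow> 'a) \<Rightarrow> letter \<Rightarrow> 'a" where
  "letter_val G \<phi> a = (if snd a then \<phi> (fst a) else inv\<^bsub>G\<^esub> \<phi> (fst a))"

definition schreier_graph ::
  "('a, 'b) monoid_scheme \<Rightarrow> nat \<Rightarrow> (nat \<Rightarrow> 'a) \<Rightarrow> 'a set \<Rightarrow> ('a set, 'a set edge) pre_digraph" where
  "schreier_graph G r \<phi> H =
    \<lparr>verts = {H #>\<^bsub>G\<^esub> g | g. g \<in> carrier G},
     arcs = {(H #>\<^bsub>G\<^esub> g, a, H #>\<^bsub>G\<^esub> (g \<otimes>\<^bsub>G\<^esub> letter_val G \<phi> a)) | g a. g \<in> carrier G \<and> a \<in> letters r},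
     tail = fst, head = (\<lambda>e. snd (snd e))\<rparr>"

definition label :: "'v edge \<Rightarrow> letter" where
  "label e = fst (snd e)"

definition inv_edge :: "'v edge \<Rightarrow> 'v edge" where
  "inv_edge e = (snd (snd e), inv_letter (label e), fst e)"

definition positive_arcs :: "('v, 'v edge) pre_digraph \<Rightarrow> 'v edge set" where
  "positive_arcs \<Gamma> = {e \<in> arcs \<Gamma>. snd (label e)}"

definition word_path :: "('v, 'v edge) pre_digraph \<Rightarrow> 'v \<Rightarrow> word \<Rightarrow> 'v edge list" where
  "word_path \<Gamma> u w = (THE p. (\<exists>v. pre_digraph.awalk \<Gamma> u p v) \<and> map label p = w)"

definition flow :: "('v, 'v edge) pre_digraph \<Rightarrow> 'v \<Rightarrow> word \<Rightarrow> 'v edge \<Rightarrow> int" where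
  "flow \<Gamma> u w = (\<lambda>e\<in>positive_arcs \<Gamma>.
     int (count_list (word_path \<Gamma> u w) e) - int (count_list (word_path \<Gamma> u w) (inv_edge e)))"

lemma schreier_graph_path_unique:
  fixes G (structure)
  assumes G: "group G" and H: "subgroup H G" and \<phi>: "\<And>j. j < r \<Longrightarrow> \<phi> j \<in> carrier G"
    and w: "w \<in> lists (letters r)" and u: "u \<in> verts (schreier_graph G r \<phi> H)"
  shows "\<exists>!p. (\<exists>v. pre_digraph.awalk (schreier_graph G r \<phi> H) u p v) \<and> map label p = w"
  using w u
proof (induction w arbitrary: u)
  case Nil
  then show ?case by (intro ex1I[of _ "[]"]) (auto simp: pre_digraph.awalk_def pre_digraph.cas.simps)
next
  case (Cons a w)
  interpret group G by (rule G)
  let ?S = "schreier_graph G r \<phi> H"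
  have a: "letter_val G \<phi> a \<in> carrier G"
    using Cons.hyps \<phi> by (auto simp: letter_val_def letters_def)
  have HG: "H \<subseteq> carrier G" using H by (rule subgroup.subset)
  obtain g where g: "g \<in> carrier G" "u = H #> g"
    using Cons.prems by (auto simp: schreier_graph_def)
  let ?u' = "H #> (g \<otimes> letter_val G \<phi> a)"
  let ?e = "(u, a, ?u')"
  have e: "?e \<in> arcs ?S" using g Cons.hyps unfolding schreier_graph_def by (cases a) auto
  have e_unique: "e' = ?e" if e': "e' \<in> arcs ?S" "fst e' = u" "label e' = a" for e'
  proof -
    obtain g' where "g' \<in> carrier G" "e' = (H #> g', a, H #> (g' \<otimes> letter_val G \<phi> a))"
      using e' by (auto simp: schreier_graph_def label_def)
    then show ?thesis
      using g e' a HG by (auto simp: coset_mult_assoc[symmetric])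
  qed
  have u': "?u' \<in> verts ?S" using g a by (auto simp: schreier_graph_def)
  have walk: "(\<exists>v. pre_digraph.awalk ?S u p v) \<and> map label p = a # w \<longleftrightarrow>
    (\<exists>q. p = ?e # q \<and> (\<exists>v. pre_digraph.awalk ?S ?u' q v) \<and> map label q = w)" for p
  proof (cases p)
    case Nil
    then show ?thesis by simp
  next
    case p: (Cons e' q)
    have [simp]: "tail ?S = fst" "head ?S = (\<lambda>e. snd (snd e))"
      by (simp_all add: schreier_graph_def)
    show ?thesis
    proof (cases "e' = ?e")
      case True
      then show ?thesis
        unfolding p using e u' Cons.prems
        by (simp add: pre_digraph.awalk_def pre_digraph.cas.simps label_def)
    next
      case False
      then show ?thesis
        unfolding p using e_unique[of e']
        by (auto simp: pre_digraph.awalk_def pre_digraph.cas.simps)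
    qed
  qed
  from Cons.IH[OF u'] obtain q where
    q: "\<And>q'. (\<exists>v. pre_digraph.awalk ?S ?u' q' v) \<and> map label q' = w \<longleftrightarrow> q' = q"
    by (auto elim!: ex1E)
  show ?case unfolding walk q by blast
qed

text \<open>
  \<open>Sch r i y\<close> is the Schreier graph of the cyclic subgroup generated by the image of \<open>y\<close> in
  \<open>free_solvable r i\<close>, and \<open>Sch_root r i y\<close> is that subgroup.
\<close>

definition Sch_root :: "nat \<Rightarrow> nat \<Rightarrow> word \<Rightarrow> word set set" where
  "Sch_root r i y = generate (free_solvable r i) {proj r i y}"

definition Sch :: "nat \<Rightarrow> nat \<Rightarrow> word \<Rightarrow> (word set set, word set set edge) pre_digraph" where
  "Sch r i y = schreier_graph (free_solvable r i) r (\<lambda>j. proj r i [(j, True)]) (Sch_root r i y)"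

lemma Sch_path_unique:
  assumes "y \<in> carrier (free_group r)" "w \<in> lists (letters r)"
  shows "\<exists>!p. (\<exists>v. pre_digraph.awalk (Sch r i y) (Sch_root r i y) p v) \<and> map label p = w"
proof -
  let ?S = "free_solvable r i" and ?H = "Sch_root r i y"
  have H: "subgroup ?H ?S"
    unfolding Sch_root_def using assms(1)
    by (intro group.generate_is_subgroup[OF group_free_solvable]) (auto intro: proj_closed)
  have "proj r i [(j, True)] \<in> carrier ?S" if "j < r" for j
    using that by (intro proj_closed) (simp add: free_group_def letters_def reduced_def)
  moreover have "?H \<in> verts (schreier_graph ?S r (\<lambda>j. proj r i [(j, True)]) ?H)"
    unfolding schreier_graph_def pre_digraph.simps mem_Collect_eq
    by (rule exI[of _ "\<one>\<^bsub>?S\<^esub>"])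
       (simp add: group.is_monoid[OF group_free_solvable] monoid.one_closed
         group.coset_mult_one[OF group_free_solvable subgroup.subset[OF H]])
  ultimately show ?thesis
    unfolding Sch_def by (intro schreier_graph_path_unique group_free_solvable H assms(2))
qed

definition Sch_flow :: "nat \<Rightarrow> nat \<Rightarrow> word \<Rightarrow> word \<Rightarrow> word set set edge \<Rightarrow> int" where
  "Sch_flow r i y w = flow (Sch r i y) (Sch_root r i y) w"

end

theory Submission
  imports Defs "HOL-Algebra.FiniteProduct" "HOL-Algebra.Elementary_Groups"
begin

text \<open>
  Let \<open>F\<close> be the free group, \<open>N\<close> its derived term number \<open>d - 1\<close>, and \<open>H\<close> the subgroup generated
  by \<open>N\<close> and \<open>y\<close>. A word labels a loop at the root of the Schreier graph exactly when it lies
  in \<open>H\<close>. The flow of a loop is its class in the first homology of the graph, which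
  is the abelianization of \<open>H\<close>; so \<open>w\<close> and \<open>y\<close> have the same flow iff \<open>w\<close> lies in \<open>H\<close> and agrees
  with \<open>y\<close> modulo \<open>[H,H]\<close>. Since \<open>N\<close> is abelian modulo \<open>[N,N]\<close> and \<open>H/N\<close> is generated by \<open>y\<close>, every
  element of \<open>[H,H]\<close> is, modulo \<open>[N,N]\<close>, of the form \<open>n y n\<inverse> y\<inverse>\<close> with \<open>n\<close> in \<open>N\<close>. Hence equal flow
  means that \<open>w\<close> is \<open>n y n\<inverse>\<close> modulo \<open>[N,N]\<close>, the next derived term; for \<open>w = z x z\<inverse>\<close> this is
  conjugacy of \<open>x\<close> and \<open>y\<close> in the free solvable group.

  Two facts about flows carry the argument. On loops the flow is additive and unchanged by free
  reduction, so it kills \<open>[N,N]\<close> (\<open>wnet_derived\<close>) and is unchanged under conjugation by elements of \<open>H\<close>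
  (\<open>flow_conj_loop\<close>); this gives one direction and the final claim on \<open>z\<close>. Conversely, if each
  edge gets a weight in a commutative group and inverse edges get inverse weights, then the product
  of the weights along a path depends only on its flow (\<open>product_determined_by_flow\<close>). The
  boundary weight with values in the integers shows that flow determines whether a path closes
  up (\<open>flow_determines_closing\<close>). Weights coming from coset representatives
  show that a homomorphism from \<open>H\<close> to a commutative group takes the same value
  on loops of equal flow (\<open>flow_determines_abelian_image\<close>). In
  \<open>conjugate_if_same_flow\<close> this is applied to the quotient of \<open>H/[N,N]\<close> by the subgroup of all
  \<open>n y n\<inverse> y\<inverse>\<close>, whose commutativity is \<open>comm_group_Mod_commutators_with\<close>.
\<close>

section \<open>Abelian quotients of cyclic extensions of abelian groups\<close>

lemma (in group) cancel_inverse_pair: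
  assumes "x \<in> carrier G" "z \<in> carrier G"
  shows "inv x \<otimes> (x \<otimes> z) = z" "x \<otimes> (inv x \<otimes> z) = z"
  using assms by (simp_all add: m_assoc[symmetric])

lemma (in group) commute_generate:
  assumes X: "X \<subseteq> carrier G" and g: "g \<in> carrier G"
    and comm: "\<And>x. x \<in> X \<Longrightarrow> g \<otimes> x = x \<otimes> g"
    and h: "h \<in> generate G X"
  shows "g \<otimes> h = h \<otimes> g"
  using h
proof (induction h rule: generate.induct)
  case one
  then show ?case using g by simp
next
  case (incl x)
  then show ?case by (rule comm)
next
  case (inv x)
  then have x: "x \<in> carrier G" using X by blast
  have "x \<otimes> (g \<otimes> inv x) = x \<otimes> (inv x \<otimes> g)"
    using comm[OF inv] x g by (metis inv_closed l_inv_ex m_assoc r_inv r_one l_one)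
  then show ?case using x g by simp
next
  case (eng h1 h2)
  have "h1 \<in> carrier G" "h2 \<in> carrier G"
    using eng generate_in_carrier[OF X] by auto
  then show ?case using eng g by (metis m_assoc)
qed

lemma (in group) comm_group_if_generators_commute:
  assumes X: "X \<subseteq> carrier G" and gen: "generate G X = carrier G"
    and comm: "\<And>x y. x \<in> X \<Longrightarrow> y \<in> X \<Longrightarrow> x \<otimes> y = y \<otimes> x"
  shows "comm_group G"
proof (rule group_comm_groupI)
  fix g h assume g: "g \<in> carrier G" and h: "h \<in> carrier G"
  have "x \<otimes> g = g \<otimes> x" if "x \<in> X" for x
    by (rule commute_generate[OF X]) (use that X g comm gen in blast)+
  then have "g \<otimes> x = x \<otimes> g" if "x \<in> X" for x using that by simp
  then show "g \<otimes> h = h \<otimes> g"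
    by (rule commute_generate[OF X g]) (use h gen in blast)+
qed

definition commutators_with :: "('a, 'b) monoid_scheme \<Rightarrow> 'a set \<Rightarrow> 'a \<Rightarrow> 'a set" where
  "commutators_with G A t = (\<lambda>a. a \<otimes>\<^bsub>G\<^esub> t \<otimes>\<^bsub>G\<^esub> inv\<^bsub>G\<^esub> a \<otimes>\<^bsub>G\<^esub> inv\<^bsub>G\<^esub> t) ` A"

text \<open>
  The map \<open>a \<mapsto> a (t a\<inverse> t\<inverse>)\<close> is a homomorphism on \<open>A\<close>, because \<open>A\<close> is abelian and contains both
  factors; the commutators with \<open>t\<close> form its image.
\<close>

lemma (in group) subgroup_commutators_with:
  assumes A: "A \<lhd> G" and abelian: "\<And>a b. a \<in> A \<Longrightarrow> b \<in> A \<Longrightarrow> a \<otimes> b = b \<otimes> a"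
    and t: "t \<in> carrier G"
  shows "subgroup (commutators_with G A t) G"
proof -
  interpret A: normal A G by (rule A)
  let ?c = "\<lambda>a. a \<otimes> t \<otimes> inv a \<otimes> inv t"
  have Ac: "a \<in> carrier G" if "a \<in> A" for a using that A.subset by blast
  have conj: "t \<otimes> inv a \<otimes> inv t \<in> A" if "a \<in> A" for a
    using A.inv_op_closed2[OF t] that by blast
  have c_alt: "?c a = a \<otimes> (t \<otimes> inv a \<otimes> inv t)" if "a \<in> A" for a
    using that t by (simp add: Ac m_assoc)
  have mult: "?c a \<otimes> ?c b = ?c (a \<otimes> b)" if a: "a \<in> A" and b: "b \<in> A" for a b
  proof -
    have "?c a \<otimes> ?c b = a \<otimes> ((t \<otimes> inv a \<otimes> inv t) \<otimes> b) \<otimes> (t \<otimes> inv b \<otimes> inv t)"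
      using a b t by (simp add: Ac m_assoc)
    also have "\<dots> = a \<otimes> (b \<otimes> (t \<otimes> inv a \<otimes> inv t)) \<otimes> (t \<otimes> inv b \<otimes> inv t)"
      using abelian[OF conj[OF a] b] by simp
    also have "\<dots> = a \<otimes> b \<otimes> (t \<otimes> (inv a \<otimes> inv b) \<otimes> inv t)"
      using a b t by (simp add: Ac m_assoc cancel_inverse_pair)
    also have "inv a \<otimes> inv b = inv (a \<otimes> b)"
      using a b abelian[OF a b] by (simp add: Ac inv_mult_group)
    finally show ?thesis using c_alt[of "a \<otimes> b"] a b by simp
  qed
  have "?c \<in> hom (G\<lparr>carrier := A\<rparr>) G"
    using t by (intro homI) (simp_all add: Ac mult)
  then interpret group_hom "G\<lparr>carrier := A\<rparr>" G ?c
    using A.subgroup_axioms subgroup_imp_group by (simp add: group_hom_def group_hom_axioms_def)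
  show ?thesis
    unfolding commutators_with_def using img_is_subgroup by simp
qed

text \<open>
  These commutators lie in the abelian group \<open>A\<close>, so conjugation by \<open>A\<close> fixes them, and conjugation
  by \<open>t\<close> merely replaces \<open>a\<close> by \<open>t a t\<inverse>\<close>.
\<close>

lemma (in group) normal_commutators_with:
  assumes A: "A \<lhd> G" and abelian: "\<And>a b. a \<in> A \<Longrightarrow> b \<in> A \<Longrightarrow> a \<otimes> b = b \<otimes> a"
    and t: "t \<in> carrier G" and gen: "generate G (insert t A) = carrier G"
  shows "commutators_with G A t \<lhd> G"
proof (rule normal_invI[OF subgroup_commutators_with[OF A abelian t]])
  interpret A: normal A G by (rule A)
  let ?C = "commutators_with G A t"
  have Ac: "a \<in> carrier G" if "a \<in> A" for a using that A.subset by blast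
  have CA: "c \<in> A" if c: "c \<in> ?C" for c
  proof -
    from c obtain a where a: "a \<in> A" "c = a \<otimes> t \<otimes> inv a \<otimes> inv t"
      by (auto simp: commutators_with_def)
    then have "c = a \<otimes> (t \<otimes> inv a \<otimes> inv t)" using t by (simp add: Ac m_assoc)
    then show ?thesis using A.inv_op_closed2[OF t, of "inv a"] a(1) by simp
  qed
  have fix_A: "b \<otimes> c \<otimes> inv b \<in> ?C" if "b \<in> A" "c \<in> ?C" for b c
    using abelian[OF that(1) CA[OF that(2)]] that Ac[OF that(1)] Ac[OF CA[OF that(2)]]
    by (simp add: m_assoc)
  (* Stated for any s commuting with t, so that it serves both t and its inverse. *)
  have conj_t: "s \<otimes> c \<otimes> inv s \<in> ?C"
    if s: "s \<in> carrier G" "s \<otimes> t = t \<otimes> s" and c: "c \<in> ?C" for s c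
  proof -
    from c obtain a where a: "a \<in> A" "c = a \<otimes> t \<otimes> inv a \<otimes> inv t"
      by (auto simp: commutators_with_def)
    let ?b = "s \<otimes> a \<otimes> inv s"
    have st: "inv s \<otimes> t = t \<otimes> inv s"
      using s t by (metis inv_closed inv_solve_left m_assoc m_closed r_inv r_one)
    have st': "inv t \<otimes> inv s = inv s \<otimes> inv t"
      using s t inv_mult_group by metis
    have "?b \<otimes> t \<otimes> inv ?b \<otimes> inv t = s \<otimes> a \<otimes> (inv s \<otimes> t) \<otimes> s \<otimes> inv a \<otimes> (inv s \<otimes> inv t)"
      using s t a by (simp add: Ac m_assoc inv_mult_group)
    also have "\<dots> = s \<otimes> a \<otimes> (t \<otimes> inv s) \<otimes> s \<otimes> inv a \<otimes> (inv t \<otimes> inv s)"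
      by (simp only: st st')
    also have "\<dots> = s \<otimes> a \<otimes> t \<otimes> (inv s \<otimes> s) \<otimes> inv a \<otimes> inv t \<otimes> inv s"
      using s t a by (simp only: Ac m_assoc m_closed inv_closed)
    also have "\<dots> = s \<otimes> c \<otimes> inv s"
      using s t a by (simp add: Ac m_assoc)
    finally show ?thesis
      using A.inv_op_closed2[OF s(1) a(1)] by (force simp: commutators_with_def)
  qed
  fix g c assume g: "g \<in> carrier G" and c: "c \<in> ?C"
  from g[folded gen] show "g \<otimes> c \<otimes> inv g \<in> ?C"
    using c
  proof (induction g arbitrary: c rule: generate.induct)
    case one
    then show ?case using Ac[OF CA] by simp
  next
    case (incl g)
    then show ?case using fix_A conj_t[OF t] by blast
  next
    case (inv g)
    have "inv t \<otimes> t = t \<otimes> inv t" using t by simp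
    then show ?case using inv fix_A[of "inv g" c] conj_t[of "inv t" c] t by auto
  next
    case (eng g1 g2)
    have "g1 \<in> carrier G" "g2 \<in> carrier G" using eng gen by auto
    then show ?case
      using eng.IH(1)[OF eng.IH(2)[OF eng.prems]] Ac[OF CA[OF eng.prems]]
      by (simp add: m_assoc inv_mult_group)
  qed
qed

text \<open>
  Modulo the commutators with \<open>t\<close>, the generator \<open>t\<close> commutes with \<open>A\<close>, so all generators commute.
  In particular \<open>commutators_with G A t\<close> contains the whole commutator subgroup.
\<close>

lemma (in group) comm_group_Mod_commutators_with:
  assumes A: "A \<lhd> G" and abelian: "\<And>a b. a \<in> A \<Longrightarrow> b \<in> A \<Longrightarrow> a \<otimes> b = b \<otimes> a"
    and t: "t \<in> carrier G" and gen: "generate G (insert t A) = carrier G"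
  shows "comm_group (G Mod commutators_with G A t)"
proof -
  interpret A: normal A G by (rule A)
  let ?C = "commutators_with G A t"
  interpret C: normal ?C G by (rule normal_commutators_with[OF assms])
  have Ac: "a \<in> carrier G" if "a \<in> A" for a using that A.subset by blast
  interpret Q: group_hom G "G Mod ?C" "\<lambda>g. ?C #> g"
    using C.r_coset_hom_Mod C.factorgroup_is_group
    by (simp add: group_hom_def group_hom_axioms_def)
  let ?X = "(\<lambda>g. ?C #> g) ` insert t A"
  have t_A: "?C #> (a \<otimes> t) = ?C #> (t \<otimes> a)" if a: "a \<in> A" for a
  proof -
    have "a \<otimes> t = (a \<otimes> t \<otimes> inv a \<otimes> inv t) \<otimes> (t \<otimes> a)"
      using t a by (simp add: Ac m_assoc cancel_inverse_pair)
    then have mem: "a \<otimes> t \<in> ?C #> (t \<otimes> a)"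
      using a unfolding commutators_with_def r_coset_def by blast
    have "t \<otimes> a \<in> carrier G" using t Ac[OF a] by simp
    from repr_independence[OF mem this C.subgroup_axioms] show ?thesis by (rule sym)
  qed
  show ?thesis
  proof (rule Q.H.comm_group_if_generators_commute)
    show "?X \<subseteq> carrier (G Mod ?C)" using t Ac by auto
    have "insert t A \<subseteq> carrier G" using t Ac by blast
    from Q.generate_img[OF this] have "generate (G Mod ?C) ?X = (\<lambda>g. ?C #> g) ` carrier G"
      by (simp only: gen)
    also have "\<dots> = carrier (G Mod ?C)"
      by (auto simp: FactGroup_def RCOSETS_def)
    finally show "generate (G Mod ?C) ?X = carrier (G Mod ?C)" .
    fix u v assume "u \<in> ?X" "v \<in> ?X"
    then obtain g h where gh: "g \<in> insert t A" "h \<in> insert t A" "u = ?C #> g" "v = ?C #> h"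
      by blast
    have "?C #> (g \<otimes> h) = ?C #> (h \<otimes> g)"
      using gh(1,2) t_A abelian by auto
    moreover have "g \<in> carrier G" "h \<in> carrier G" using gh(1,2) t Ac by auto
    ultimately show "u \<otimes>\<^bsub>G Mod ?C\<^esub> v = v \<otimes>\<^bsub>G Mod ?C\<^esub> u"
      using gh(3,4) by (metis Q.hom_mult)
  qed
qed

section \<open>Products along edge lists\<close>

text \<open>
  Unlike \<open>flow\<close>, which is restricted to positive edges of a graph, this count is defined on all
  edges; it changes sign under inversion of the edge.
\<close>

definition net :: "'v edge list \<Rightarrow> 'v edge \<Rightarrow> int" where
  "net es e = int (count_list es e) - int (count_list es (inv_edge e))"

lemma inv_edge_inv_edge [simp]: "inv_edge (inv_edge e) = e"
  by (simp add: inv_edge_def label_def)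

lemma snd_label_inv_edge [simp]: "snd (label (inv_edge e)) \<longleftrightarrow> \<not> snd (label e)"
  by (simp add: inv_edge_def label_def inv_letter_def)

lemma net_Nil [simp]: "net [] e = 0"
  by (simp add: net_def)

lemma net_Cons: "net (a # es) e = of_bool (a = e) - of_bool (inv_edge a = e) + net es e"
proof -
  have "a = inv_edge e \<longleftrightarrow> inv_edge a = e" by auto
  then show ?thesis by (simp add: net_def)
qed

text \<open>
  In a commutative group the factors can be collected edge by edge; traversing \<open>e\<close> backwards
  contributes \<open>(h e)\<inverse>\<close>, so the exponent of \<open>h e\<close> is the net number of traversals.
\<close>

lemma (in comm_group) product_along_edges:
  assumes E: "finite E" "\<And>e. e \<in> E \<Longrightarrow> snd (label e)"
    and h: "\<And>e. e \<in> E \<Longrightarrow> h e \<in> carrier G" "\<And>e. e \<in> E \<Longrightarrow> h (inv_edge e) = inv (h e)"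
    and es: "set es \<subseteq> E \<union> inv_edge ` E"
  shows "foldr (\<lambda>e. (\<otimes>) (h e)) es \<one> = (\<Otimes>e\<in>E. h e [^] net es e)"
  using es
proof (induction es)
  case Nil
  then show ?case by (simp add: finprod_one_eqI)
next
  case (Cons a es)
  have "(\<Otimes>e\<in>E. h e [^] net (a # es) e)
      = (\<Otimes>e\<in>E. h e [^] (of_bool (a = e) - of_bool (inv_edge a = e) :: int) \<otimes> h e [^] net es e)"
    by (intro finprod_cong') (auto simp: net_Cons h int_pow_mult)
  also have "\<dots> = (\<Otimes>e\<in>E. h e [^] (of_bool (a = e) - of_bool (inv_edge a = e) :: int))
      \<otimes> (\<Otimes>e\<in>E. h e [^] net es e)"
    by (intro finprod_multf) (auto simp: h)
  also have "(\<Otimes>e\<in>E. h e [^] (of_bool (a = e) - of_bool (inv_edge a = e) :: int)) = h a"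
  proof (cases "a \<in> E")
    case True
    (* Only one of the two indicators can fire, since E consists of positive edges. *)
    have "inv_edge a \<noteq> e" if "e \<in> E" for e
      using that True E(2) snd_label_inv_edge by metis
    then have "(\<Otimes>e\<in>E. h e [^] (of_bool (a = e) - of_bool (inv_edge a = e) :: int))
        = (\<Otimes>e\<in>E. if a = e then h e else \<one>)"
      by (intro finprod_cong') (auto simp: h)
    also have "\<dots> = h a" using True E(1) h(1) by (intro finprod_singleton) auto
    finally show ?thesis .
  next
    case False
    then obtain b where b: "b \<in> E" "a = inv_edge b" using Cons.prems by auto
    have "a \<noteq> e" if "e \<in> E" for e
      using that b E(2) snd_label_inv_edge by metis
    then have "(\<Otimes>e\<in>E. h e [^] (of_bool (a = e) - of_bool (inv_edge a = e) :: int))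
        = (\<Otimes>e\<in>E. if b = e then inv (h e) else \<one>)"
      using b by (intro finprod_cong') (auto simp: h int_pow_neg)
    also have "\<dots> = inv (h b)" using b E(1) h(1) by (intro finprod_singleton) auto
    finally show ?thesis using b h(2) by simp
  qed
  finally show ?case using Cons by simp
qed

lemma (in comm_group) product_determined_by_net:
  assumes P: "\<And>e. e \<in> P \<Longrightarrow> snd (label e)"
    and h: "\<And>e. e \<in> P \<Longrightarrow> h e \<in> carrier G" "\<And>e. e \<in> P \<Longrightarrow> h (inv_edge e) = inv (h e)"
    and es: "set es \<subseteq> P \<union> inv_edge ` P" and es': "set es' \<subseteq> P \<union> inv_edge ` P"
    and net: "\<And>e. e \<in> P \<Longrightarrow> net es e = net es' e"
  shows "foldr (\<lambda>e. (\<otimes>) (h e)) es \<one> = foldr (\<lambda>e. (\<otimes>) (h e)) es' \<one>"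
proof -
  let ?s = "set es \<union> set es'"
  (* The finite product needs a finite set of edges: those of P that one of the lists meets. *)
  define E where "E = P \<inter> (?s \<union> inv_edge ` ?s)"
  have E: "finite E" "E \<subseteq> P" by (auto simp: E_def)
  have "?s \<subseteq> E \<union> inv_edge ` E"
  proof
    fix e assume e: "e \<in> ?s"
    then consider "e \<in> P" | b where "b \<in> P" "e = inv_edge b" using es es' by blast
    then show "e \<in> E \<union> inv_edge ` E"
    proof cases
      case 1
      then show ?thesis using e by (auto simp: E_def)
    next
      case 2
      then have "b = inv_edge e" by simp
      then show ?thesis using 2 e unfolding E_def by blast
    qed
  qed
  then have "foldr (\<lambda>e. (\<otimes>) (h e)) es \<one> = (\<Otimes>e\<in>E. h e [^] net es e)"
    "foldr (\<lambda>e. (\<otimes>) (h e)) es' \<one> = (\<Otimes>e\<in>E. h e [^] net es' e)"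
    using E P h by (auto intro!: product_along_edges)
  moreover have "(\<Otimes>e\<in>E. h e [^] net es e) = (\<Otimes>e\<in>E. h e [^] net es' e)"
    using E h net by (intro finprod_cong') auto
  ultimately show ?thesis by simp
qed

section \<open>Reduced words\<close>

lemma mem_free_group: "w \<in> carrier (free_group r) \<longleftrightarrow> w \<in> lists (letters r) \<and> reduced w"
  by (simp add: free_group_def)

lemma free_group_mult: "u \<otimes>\<^bsub>free_group r\<^esub> v = reduce (u @ v)"
  by (simp add: free_group_def)

lemma free_group_one: "\<one>\<^bsub>free_group r\<^esub> = []"
  by (simp add: free_group_def)

lemma letter_in_free_group: "[a] \<in> carrier (free_group r) \<longleftrightarrow> a \<in> letters r"
  by (auto simp: mem_free_group reduced_def)

lemma free_group_Cons:
  assumes "a # w \<in> carrier (free_group r)"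
  shows "a \<in> letters r" "w \<in> carrier (free_group r)" "a # w = [a] \<otimes>\<^bsub>free_group r\<^esub> w"
  using assms by (auto simp: mem_free_group free_group_mult reduce_reduced dest: reduced_ConsD)

lemma free_group_Cons_mult:
  assumes "v \<in> carrier (free_group r)"
  shows "(a # u) \<otimes>\<^bsub>free_group r\<^esub> v = cancel_Cons a (u \<otimes>\<^bsub>free_group r\<^esub> v)"
  using assms by (simp add: mem_free_group free_group_mult reduce_append del: append_Cons)

lemma inv_letter_word:
  assumes "a \<in> letters r"
  shows "inv\<^bsub>free_group r\<^esub> [a] = [inv_letter a]"
  using assms
  by (intro group.inv_equality[OF group_free_group])
     (auto simp: letter_in_free_group free_group_mult free_group_one reduce_def)

section \<open>Paths in a Schreier graph\<close>

text \<open>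
  The setting is a quotient \<open>p\<close> of the free group onto \<open>S\<close>, and the Schreier graph of a
  subgroup \<open>R\<close> of \<open>S\<close>. The set \<open>loops\<close> below is the preimage of \<open>R\<close>, that is, the set of reduced
  words whose path from the root is closed.
\<close>

locale coset_flow =
  P: group_hom "free_group r" S p + R: subgroup R S
  for r :: nat and S (structure) and p and R +
  assumes surj: "p ` carrier (free_group r) = carrier S"
begin

abbreviation F where "F \<equiv> free_group r"

abbreviation \<Gamma> where "\<Gamma> \<equiv> schreier_graph S r (\<lambda>j. p [(j, True)]) R"

definition loops :: "word set" where
  "loops = {w \<in> carrier F. p w \<in> R}"

text \<open>
  The path labeled \<open>w\<close> from \<open>U\<close>, computed letter by letter; \<open>word_path_eq\<close> identifies it with the
  path that \<open>word_path\<close> describes by uniqueness.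
\<close>

primrec coset_path :: "'a set \<Rightarrow> word \<Rightarrow> 'a set edge list" where
  "coset_path U [] = []"
| "coset_path U (a # w) = (U, a, U #> p [a]) # coset_path (U #> p [a]) w"

abbreviation wnet :: "'a set \<Rightarrow> word \<Rightarrow> 'a set edge \<Rightarrow> int" where
  "wnet U w \<equiv> net (coset_path U w)"

lemma p_letter_closed: "a \<in> letters r \<Longrightarrow> p [a] \<in> carrier S"
  by (simp add: letter_in_free_group)

lemma p_inv_letter: "a \<in> letters r \<Longrightarrow> p [inv_letter a] = inv p [a]"
  by (metis inv_letter_word letter_in_free_group P.hom_inv)

lemma p_Cons: "a # w \<in> carrier F \<Longrightarrow> p (a # w) = p [a] \<otimes> p w"
  using free_group_Cons[of a w r] letter_in_free_group P.hom_mult by metis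

lemma letter_val_eq: "a \<in> letters r \<Longrightarrow> letter_val S (\<lambda>j. p [(j, True)]) a = p [a]"
  using p_inv_letter[of "(fst a, True)"]
  by (cases a) (auto simp: letter_val_def inv_letter_def letters_def)

lemma subgroup_loops: "subgroup loops F"
  by (rule P.G.subgroupI) (auto simp: loops_def intro: exI[of _ "\<one>\<^bsub>F\<^esub>"])

lemma translate_back:
  assumes "U \<subseteq> carrier S" "a \<in> letters r"
  shows "U #> p [a] #> p [inv_letter a] = U"
  using assms by (simp add: p_inv_letter p_letter_closed P.H.coset_mult_assoc)

text \<open>
  A cancelling pair of letters traverses an edge and immediately its inverse, which contributes
  zero to every net count. Hence free reduction preserves the flow.
\<close>

lemma wnet_cancel_Cons:
  assumes U: "U \<subseteq> carrier S" and a: "a \<in> letters r"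
  shows "wnet U (cancel_Cons a w) e = wnet U (a # w) e"
proof (cases "\<exists>v. w = inv_letter a # v")
  case True
  then obtain v where v: "w = inv_letter a # v" by blast
  have "inv_edge (U, a, U #> p [a]) = (U #> p [a], inv_letter a, U)"
    by (simp add: inv_edge_def label_def)
  then show ?thesis
    using U a by (simp add: v translate_back net_Cons inv_edge_def label_def)
next
  case False
  then show ?thesis by (cases w) auto
qed

text \<open>
  Concatenation adds flows, the second path starting where the first one ends; by the preceding
  lemma the reduction hidden in the product of the free group does no harm.
\<close>

lemma wnet_mult:
  assumes U: "U \<subseteq> carrier S" and u: "u \<in> carrier F" and v: "v \<in> carrier F"
  shows "wnet U (u \<otimes>\<^bsub>F\<^esub> v) e = wnet U u e + wnet (U #> p u) v e"
  using U u
proof (induction u arbitrary: U)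
  case Nil
  have "p [] = \<one>" using P.hom_one by (simp add: free_group_one)
  moreover have "[] \<otimes>\<^bsub>F\<^esub> v = v" using v P.G.l_one by (metis free_group_one)
  ultimately show ?case
    unfolding \<open>[] \<otimes>\<^bsub>F\<^esub> v = v\<close> using Nil by (simp add: P.H.coset_mult_one)
next
  case (Cons a u)
  note c = free_group_Cons[OF Cons.prems(2)]
  have U': "U #> p [a] \<subseteq> carrier S"
    using Cons.prems c by (simp add: P.H.r_coset_subset_G p_letter_closed)
  have "U #> p [a] #> p u = U #> p (a # u)"
    using Cons.prems c(1,2) by (simp add: p_Cons[OF Cons.prems(2)] P.H.coset_mult_assoc p_letter_closed)
  then show ?case
    using Cons.IH[OF U' c(2)] Cons.prems(1) c(1)
    by (simp add: free_group_Cons_mult[OF v] wnet_cancel_Cons net_Cons)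
qed

section \<open>Flows of loops\<close>

lemma root_fixed: "w \<in> loops \<Longrightarrow> R #> p w = R"
  by (simp add: loops_def R.rcos_const P.H.group_axioms)

lemma wnet_loops_mult:
  assumes "u \<in> loops" "v \<in> carrier F"
  shows "wnet R (u \<otimes>\<^bsub>F\<^esub> v) e = wnet R u e + wnet R v e"
  using wnet_mult[of R u v e] assms root_fixed R.subset by (simp add: loops_def)

lemma wnet_one: "wnet R \<one>\<^bsub>F\<^esub> e = 0"
  by (simp add: free_group_one)

lemma wnet_loops_inv:
  assumes u: "u \<in> loops"
  shows "wnet R (inv\<^bsub>F\<^esub> u) e = - wnet R u e"
proof -
  have "u \<in> carrier F" using u by (simp add: loops_def)
  then show ?thesis using wnet_loops_mult[OF u, of "inv\<^bsub>F\<^esub> u" e] wnet_one by simp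
qed

text \<open>
  On loops the net count is a homomorphism into the integers, so it vanishes on commutators of loops.
\<close>

lemma wnet_derived:
  assumes N: "N \<subseteq> loops" and c: "c \<in> derived F N"
  shows "wnet R c e = 0"
proof -
  interpret L: subgroup loops F by (rule subgroup_loops)
  have commutator: "c \<in> loops \<and> wnet R c e = 0" if "c \<in> derived_set F N" for c
  proof -
    from that obtain a b where ab: "a \<in> loops" "b \<in> loops" "c = a \<otimes>\<^bsub>F\<^esub> b \<otimes>\<^bsub>F\<^esub> inv\<^bsub>F\<^esub> a \<otimes>\<^bsub>F\<^esub> inv\<^bsub>F\<^esub> b"
      using N by blast
    then show ?thesis by (simp add: wnet_loops_mult wnet_loops_inv)
  qed
  from c have "c \<in> generate F (derived_set F N)" by (simp add: derived_def)
  then have "c \<in> loops \<and> wnet R c e = 0"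
  proof (induction c rule: generate.induct)
    case one
    then show ?case by (simp add: wnet_one)
  next
    case (incl c)
    then show ?case by (rule commutator)
  next
    case (inv c)
    then show ?case using commutator by (simp add: wnet_loops_inv)
  next
    case (eng c d)
    then show ?case by (simp add: wnet_loops_mult)
  qed
  then show ?thesis by simp
qed

section \<open>Flow and edge weights\<close>

lemma mem_arcs:
  "e \<in> arcs \<Gamma> \<longleftrightarrow> (\<exists>g\<in>carrier S. \<exists>a\<in>letters r. e = (R #> g, a, R #> g #> p [a]))"
proof -
  have "R #> (g \<otimes> letter_val S (\<lambda>j. p [(j, True)]) a) = R #> g #> p [a]"
    if "g \<in> carrier S" "a \<in> letters r" for g a
    using that R.subset by (simp add: letter_val_eq P.H.coset_mult_assoc p_letter_closed)
  then show ?thesis by (auto simp: schreier_graph_def) metis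
qed

lemma inv_edge_in_arcs: "e \<in> arcs \<Gamma> \<Longrightarrow> inv_edge e \<in> arcs \<Gamma>"
proof -
  assume "e \<in> arcs \<Gamma>"
  then obtain g a where g: "g \<in> carrier S" "a \<in> letters r" "e = (R #> g, a, R #> g #> p [a])"
    unfolding mem_arcs by blast
  have "R #> g #> p [a] = R #> (g \<otimes> p [a])"
    using g R.subset by (simp add: P.H.coset_mult_assoc p_letter_closed)
  moreover have "R #> g \<subseteq> carrier S"
    using g R.subset by (simp add: P.H.r_coset_subset_G)
  ultimately have "inv_edge e = (R #> (g \<otimes> p [a]), inv_letter a, R #> (g \<otimes> p [a]) #> p [inv_letter a])"
    using g translate_back[of "R #> g" a] by (simp add: inv_edge_def label_def)
  then show ?thesis
    unfolding mem_arcs using g p_letter_closed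
    by (intro bexI[of _ "g \<otimes> p [a]"] bexI[of _ "inv_letter a"]) auto
qed

lemma arcs_eq_positive: "arcs \<Gamma> = positive_arcs \<Gamma> \<union> inv_edge ` positive_arcs \<Gamma>"
proof -
  have "e \<in> inv_edge ` positive_arcs \<Gamma>" if "e \<in> arcs \<Gamma>" "\<not> snd (label e)" for e
    using that by (intro image_eqI[of _ _ "inv_edge e"]) (auto simp: positive_arcs_def inv_edge_in_arcs)
  then show ?thesis by (auto simp: positive_arcs_def inv_edge_in_arcs)
qed

lemma coset_path_walk:
  assumes "w \<in> lists (letters r)" "U \<in> verts \<Gamma>"
  shows "(\<exists>v. pre_digraph.awalk \<Gamma> U (coset_path U w) v) \<and> map label (coset_path U w) = w"
  using assms
proof (induction w arbitrary: U)
  case Nil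
  then show ?case by (auto simp: pre_digraph.awalk_def pre_digraph.cas.simps)
next
  case (Cons a w)
  obtain g where g: "g \<in> carrier S" "U = R #> g"
    using Cons.prems by (auto simp: schreier_graph_def)
  have e: "(U, a, U #> p [a]) \<in> arcs \<Gamma>" using g Cons.hyps unfolding mem_arcs by auto
  have "U #> p [a] = R #> (g \<otimes> p [a])"
    using g Cons.hyps R.subset by (simp add: P.H.coset_mult_assoc p_letter_closed)
  then have U': "U #> p [a] \<in> verts \<Gamma>"
    using g Cons.hyps by (auto simp: schreier_graph_def p_letter_closed)
  have [simp]: "tail \<Gamma> = fst" "head \<Gamma> = (\<lambda>e. snd (snd e))"
    by (simp_all add: schreier_graph_def)
  from Cons.IH[OF U'] e Cons.prems show ?case
    by (auto simp: pre_digraph.awalk_def pre_digraph.cas.simps label_def)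
qed

lemma root_vertex: "R \<in> verts \<Gamma>"
proof -
  have "R #> \<one> = R" using R.subset by (simp add: P.H.coset_mult_one)
  then show ?thesis using P.H.one_closed by (force simp: schreier_graph_def)
qed

lemma word_path_eq:
  assumes w: "w \<in> lists (letters r)"
  shows "word_path \<Gamma> R w = coset_path R w"
proof -
  have "\<exists>!es. (\<exists>v. pre_digraph.awalk \<Gamma> R es v) \<and> map label es = w"
    using w root_vertex
    by (intro schreier_graph_path_unique P.H.group_axioms R.subgroup_axioms p_letter_closed)
       (auto simp: letters_def)
  then show ?thesis
    unfolding word_path_def using coset_path_walk[OF w root_vertex] by (rule the1_equality)
qed

lemma coset_path_arcs:
  assumes "w \<in> lists (letters r)"
  shows "set (coset_path R w) \<subseteq> arcs \<Gamma>"
  using coset_path_walk[OF assms root_vertex] by (auto simp: pre_digraph.awalk_def)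

lemma flow_eq_iff:
  assumes "v \<in> carrier F" "w \<in> carrier F"
  shows "flow \<Gamma> R v = flow \<Gamma> R w \<longleftrightarrow> (\<forall>e\<in>positive_arcs \<Gamma>. wnet R v e = wnet R w e)"
proof -
  have "flow \<Gamma> R u = (\<lambda>e\<in>positive_arcs \<Gamma>. wnet R u e)" if "u \<in> carrier F" for u
    using that by (simp add: flow_def word_path_eq mem_free_group net_def del: in_lists_conv_set)
  then show ?thesis using assms by (auto simp: restrict_def fun_eq_iff)
qed

text \<open>
  The lemma \<open>product_determined_by_net\<close>, read in the Schreier graph: every arc is positive or
  inverse to a positive arc.
\<close>

lemma product_determined_by_flow:
  fixes A (structure)
  assumes A: "comm_group A"
    and h: "\<And>e. e \<in> arcs \<Gamma> \<Longrightarrow> h e \<in> carrier A"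
      "\<And>e. e \<in> arcs \<Gamma> \<Longrightarrow> h (inv_edge e) = inv\<^bsub>A\<^esub> h e"
    and vw: "v \<in> carrier F" "w \<in> carrier F" and flow: "flow \<Gamma> R v = flow \<Gamma> R w"
  shows "foldr (\<lambda>e. (\<otimes>\<^bsub>A\<^esub>) (h e)) (coset_path R v) \<one>\<^bsub>A\<^esub>
    = foldr (\<lambda>e. (\<otimes>\<^bsub>A\<^esub>) (h e)) (coset_path R w) \<one>\<^bsub>A\<^esub>"
proof (rule comm_group.product_determined_by_net[OF A, of "positive_arcs \<Gamma>"])
  show "set (coset_path R v) \<subseteq> positive_arcs \<Gamma> \<union> inv_edge ` positive_arcs \<Gamma>"
    "set (coset_path R w) \<subseteq> positive_arcs \<Gamma> \<union> inv_edge ` positive_arcs \<Gamma>"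
    using coset_path_arcs vw unfolding arcs_eq_positive[symmetric] by (auto simp: mem_free_group)
qed (use h flow flow_eq_iff[OF vw] in \<open>auto simp: positive_arcs_def\<close>)

text \<open>
  The weight of an edge is its contribution to the boundary at the root: \<open>1\<close> if it ends there,
  minus \<open>1\<close> if it starts there. The contributions at inner visits of the path cancel.
\<close>

lemma boundary_telescopes:
  assumes "w \<in> carrier F" "U \<subseteq> carrier S"
  shows "foldr (\<lambda>e. (\<otimes>\<^bsub>integer_group\<^esub>) (of_bool (snd (snd e) = R) - of_bool (fst e = R)))
      (coset_path U w) \<one>\<^bsub>integer_group\<^esub> = of_bool (U #> p w = R) - of_bool (U = R)"
  using assms
proof (induction w arbitrary: U)
  case Nil
  have "p [] = \<one>" using P.hom_one by (simp add: free_group_one)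
  then show ?case using Nil by (simp add: P.H.coset_mult_one)
next
  case (Cons a w)
  note c = free_group_Cons[OF Cons.prems(1)]
  have U': "U #> p [a] \<subseteq> carrier S"
    using Cons.prems c by (simp add: P.H.r_coset_subset_G p_letter_closed)
  have "U #> p [a] #> p w = U #> p (a # w)"
    using Cons.prems c(1,2) by (simp add: p_Cons[OF Cons.prems(1)] P.H.coset_mult_assoc p_letter_closed)
  then show ?case using Cons.IH[OF c(2) U'] by simp
qed

text \<open>
  The total boundary at the root is zero for the loop \<open>y\<close>; for \<open>w\<close>, which starts at the root,
  zero means that the path also ends there.
\<close>

lemma flow_determines_closing:
  assumes y: "y \<in> loops" and w: "w \<in> carrier F" and flow: "flow \<Gamma> R w = flow \<Gamma> R y"
  shows "w \<in> loops"
proof -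
  let ?h = "\<lambda>e :: 'a set edge. of_bool (snd (snd e) = R) - of_bool (fst e = R) :: int"
  have "foldr (\<lambda>e. (\<otimes>\<^bsub>integer_group\<^esub>) (?h e)) (coset_path R w) \<one>\<^bsub>integer_group\<^esub>
    = foldr (\<lambda>e. (\<otimes>\<^bsub>integer_group\<^esub>) (?h e)) (coset_path R y) \<one>\<^bsub>integer_group\<^esub>"
    using w y flow
    by (intro product_determined_by_flow abelian_integer_group) (auto simp: loops_def inv_edge_def)
  moreover have yF: "y \<in> carrier F" using y by (simp add: loops_def)
  ultimately have "R #> p w = R"
    using root_fixed[OF y] boundary_telescopes[OF w R.subset] boundary_telescopes[OF yF R.subset]
    by (simp split: if_splits)
  then have "p w \<in> R"
    by (rule P.H.coset_join1[OF _ P.hom_closed[OF w] R.subgroup_axioms])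
  then show ?thesis using w by (simp add: loops_def)
qed

text \<open>
  A word leading from the root to the given vertex. The choice is arbitrary; even at the root
  itself it may be a nontrivial loop.
\<close>

definition rep :: "'a set \<Rightarrow> word" where
  "rep U = (SOME t. t \<in> carrier F \<and> R #> p t = U)"

lemma rep:
  assumes "g \<in> carrier S"
  shows "rep (R #> g) \<in> carrier F" "R #> p (rep (R #> g)) = R #> g"
proof -
  obtain t where "t \<in> carrier F" "p t = g" using assms surj by (metis imageE)
  then have "\<exists>t. t \<in> carrier F \<and> R #> p t = R #> g" by blast
  then have "rep (R #> g) \<in> carrier F \<and> R #> p (rep (R #> g)) = R #> g"
    unfolding rep_def by (rule someI_ex)
  then show "rep (R #> g) \<in> carrier F" "R #> p (rep (R #> g)) = R #> g" by auto
qed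

text \<open>
  A path from \<open>U\<close> to \<open>V\<close> becomes a loop at the root when it is joined to the root by the chosen
  representatives. For single edges these are the Schreier generators of \<open>loops\<close>.
\<close>

definition closed_up :: "'a set \<Rightarrow> word \<Rightarrow> 'a set \<Rightarrow> word" where
  "closed_up U w V = rep U \<otimes>\<^bsub>F\<^esub> w \<otimes>\<^bsub>F\<^esub> inv\<^bsub>F\<^esub> rep V"

lemma closed_up_loops:
  assumes g: "g \<in> carrier S" and w: "w \<in> carrier F"
  shows "closed_up (R #> g) w (R #> g #> p w) \<in> loops"
proof -
  let ?s = "rep (R #> g)" and ?t = "rep (R #> (g \<otimes> p w))"
  have gw: "g \<otimes> p w \<in> carrier S" and st: "?s \<in> carrier F" "?t \<in> carrier F"
    using g w rep by auto
  have "R #> (p ?s \<otimes> p w) = R #> p ?t"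
    using rep(2)[OF g] rep(2)[OF gw] g w st R.subset by (simp add: P.H.coset_mult_assoc[symmetric])
  moreover have "R #> (p ?s \<otimes> p w \<otimes> inv p ?t) = R #> (p ?s \<otimes> p w) #> inv p ?t"
    using st w R.subset by (simp add: P.H.coset_mult_assoc)
  moreover have "R #> p ?t #> inv p ?t = R"
    using st R.subset by (simp add: P.H.coset_mult_assoc P.H.coset_mult_one)
  ultimately have "R #> (p ?s \<otimes> p w \<otimes> inv p ?t) = R" by simp
  moreover have "p ?s \<otimes> p w \<otimes> inv p ?t \<in> carrier S"
    using st w by simp
  ultimately have "p ?s \<otimes> p w \<otimes> inv p ?t \<in> R"
    by (rule P.H.coset_join1[OF _ _ R.subgroup_axioms])
  then show ?thesis
    using st w g R.subset by (simp add: loops_def closed_up_def P.H.coset_mult_assoc)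
qed

text \<open>
  Give each edge the image under \<open>\<psi>\<close> of its Schreier generator. Along a path the representatives of
  inner vertices cancel, so a loop \<open>v\<close> has total weight \<open>\<psi> (t v t\<inverse>)\<close>, where \<open>t\<close> represents the root.
  This is \<open>\<psi> v\<close>, as \<open>t\<close> is a loop and the target is commutative. So \<open>\<psi> v\<close> depends
  only on the flow of \<open>v\<close>.
\<close>

lemma flow_determines_abelian_image:
  fixes A (structure)
  assumes A: "comm_group A" and \<psi>: "\<psi> \<in> hom (F\<lparr>carrier := loops\<rparr>) A"
    and y: "y \<in> loops" and w: "w \<in> loops" and flow: "flow \<Gamma> R w = flow \<Gamma> R y"
  shows "\<psi> w = \<psi> y"
proof -
  interpret A: comm_group A by (rule A)
  interpret L: subgroup loops F by (rule subgroup_loops)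
  interpret L: group_hom "F\<lparr>carrier := loops\<rparr>" A \<psi>
    using \<psi> P.G.subgroup_imp_group[OF subgroup_loops]
    by (simp add: group_hom_def group_hom_axioms_def A.group_axioms)
  have mult: "\<psi> (u \<otimes>\<^bsub>F\<^esub> v) = \<psi> u \<otimes>\<^bsub>A\<^esub> \<psi> v" if "u \<in> loops" "v \<in> loops" for u v
    using that L.hom_mult by simp
  have closed: "\<psi> u \<in> carrier A" if "u \<in> loops" for u
    using that L.hom_closed by simp
  have inv: "\<psi> (inv\<^bsub>F\<^esub> u) = inv\<^bsub>A\<^esub> \<psi> u" if "u \<in> loops" for u
    using that L.hom_inv[of u] P.G.m_inv_consistent[OF subgroup_loops that] by simp
  define h where "h e = \<psi> (closed_up (fst e) [label e] (snd (snd e)))" for e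
  have rep_inv: "inv\<^bsub>F\<^esub> closed_up U v V = closed_up V (inv\<^bsub>F\<^esub> v) U"
    if "rep U \<in> carrier F" "rep V \<in> carrier F" "v \<in> carrier F" for U V v
    using that by (simp add: closed_up_def P.G.inv_mult_group P.G.m_assoc)
  have h: "h e \<in> carrier A \<and> h (inv_edge e) = inv\<^bsub>A\<^esub> h e" if e: "e \<in> arcs \<Gamma>" for e
  proof -
    obtain g a where g: "g \<in> carrier S" "a \<in> letters r" "e = (R #> g, a, R #> g #> p [a])"
      using e unfolding mem_arcs by blast
    have a: "[a] \<in> carrier F" using g by (simp add: letter_in_free_group)
    have l: "closed_up (R #> g) [a] (R #> g #> p [a]) \<in> loops"
      by (rule closed_up_loops[OF g(1) a])
    have "R #> g #> p [a] = R #> (g \<otimes> p [a])"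
      using g R.subset by (simp add: P.H.coset_mult_assoc p_letter_closed)
    then have "rep (R #> g #> p [a]) \<in> carrier F" "rep (R #> g) \<in> carrier F"
      using rep(1) g p_letter_closed by auto
    then show ?thesis
      using l inv[OF l] closed[OF l] a g(2)
      by (simp add: h_def g(3) label_def inv_edge_def rep_inv inv_letter_word)
  qed
  have telescope: "foldr (\<lambda>e. (\<otimes>\<^bsub>A\<^esub>) (h e)) (coset_path (R #> g) v) \<one>\<^bsub>A\<^esub>
      = \<psi> (closed_up (R #> g) v (R #> g #> p v))"
    if "v \<in> carrier F" "g \<in> carrier S" for v g
    using that
  proof (induction v arbitrary: g)
    case Nil
    have "p [] = \<one>" using P.hom_one by (simp add: free_group_one)
    moreover have "\<psi> \<one>\<^bsub>F\<^esub> = \<one>\<^bsub>A\<^esub>" using L.hom_one by simp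
    moreover have "closed_up (R #> g) \<one>\<^bsub>F\<^esub> (R #> g) = \<one>\<^bsub>F\<^esub>"
      using rep(1)[OF Nil(2)] by (simp add: closed_up_def)
    ultimately show ?case
      using Nil R.subset by (simp add: P.H.coset_mult_assoc free_group_one)
  next
    case (Cons a v)
    note c = free_group_Cons[OF Cons.prems(1)]
    have a: "[a] \<in> carrier F" using c by (simp add: letter_in_free_group)
    let ?g = "g \<otimes> p [a]"
    have g': "?g \<in> carrier S" using Cons.prems a by simp
    have eq: "R #> g #> p [a] = R #> ?g" "R #> ?g #> p v = R #> g #> p (a # v)"
      using Cons.prems a c(2) R.subset
      by (simp_all add: P.H.coset_mult_assoc p_Cons[OF Cons.prems(1)] P.H.m_assoc)
    let ?l1 = "closed_up (R #> g) [a] (R #> g #> p [a])"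
    let ?l2 = "closed_up (R #> ?g) v (R #> ?g #> p v)"
    have reps: "rep (R #> g) \<in> carrier F" "rep (R #> ?g) \<in> carrier F"
      "rep (R #> ?g #> p v) \<in> carrier F"
      using rep(1) Cons.prems g' c(2) R.subset by (simp_all add: P.H.coset_mult_assoc)
    have "?l1 \<otimes>\<^bsub>F\<^esub> ?l2 = rep (R #> g) \<otimes>\<^bsub>F\<^esub> ([a] \<otimes>\<^bsub>F\<^esub> v) \<otimes>\<^bsub>F\<^esub> inv\<^bsub>F\<^esub> rep (R #> ?g #> p v)"
      using reps a c(2) unfolding closed_up_def eq(1)
      by (simp add: P.G.m_assoc P.G.cancel_inverse_pair)
    then have "?l1 \<otimes>\<^bsub>F\<^esub> ?l2 = closed_up (R #> g) (a # v) (R #> g #> p (a # v))"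
      using c(3) eq(2) by (simp add: closed_up_def)
    moreover have "?l1 \<in> loops" "?l2 \<in> loops"
      using closed_up_loops Cons.prems(2) a g' c(2) by auto
    ultimately show ?case
      using Cons.IH[OF c(2) g'] mult[of ?l1 ?l2] eq(1) by (simp add: h_def label_def)
  qed
  have at_root: "foldr (\<lambda>e. (\<otimes>\<^bsub>A\<^esub>) (h e)) (coset_path R v) \<one>\<^bsub>A\<^esub> = \<psi> v" if v: "v \<in> loops" for v
  proof -
    have R1: "R #> \<one> = R" using R.subset by (simp add: P.H.coset_mult_one)
    have rF: "rep R \<in> carrier F" and rR: "R #> p (rep R) = R"
      using rep[OF P.H.one_closed, unfolded R1] .
    have "p (rep R) \<in> R"
      by (rule P.H.coset_join1[OF rR P.hom_closed[OF rF] R.subgroup_axioms])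
    then have r: "rep R \<in> loops" using rF unfolding loops_def by blast
    have "v \<in> carrier F" using v by simp
    then have "foldr (\<lambda>e. (\<otimes>\<^bsub>A\<^esub>) (h e)) (coset_path R v) \<one>\<^bsub>A\<^esub> = \<psi> (closed_up R v R)"
      using telescope[OF _ P.H.one_closed, unfolded R1] root_fixed[OF v] by simp
    also have "\<dots> = \<psi> (rep R) \<otimes>\<^bsub>A\<^esub> \<psi> v \<otimes>\<^bsub>A\<^esub> inv\<^bsub>A\<^esub> \<psi> (rep R)"
      using r v by (simp add: closed_up_def mult inv)
    also have "\<dots> = \<psi> v"
      using closed[OF r] closed[OF v] by (simp add: A.m_comm[of "\<psi> (rep R)"] A.m_assoc)
    finally show ?thesis .
  qed
  have "foldr (\<lambda>e. (\<otimes>\<^bsub>A\<^esub>) (h e)) (coset_path R w) \<one>\<^bsub>A\<^esub>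
      = foldr (\<lambda>e. (\<otimes>\<^bsub>A\<^esub>) (h e)) (coset_path R y) \<one>\<^bsub>A\<^esub>"
    using h w y flow by (intro product_determined_by_flow A) auto
  then show ?thesis using at_root w y by simp
qed

text \<open>
  Equal flow forces \<open>w\<close> to be a loop, and for loops the contributions of \<open>n\<close> and \<open>n\<inverse>\<close> cancel.
\<close>

lemma flow_conj_loop:
  assumes y: "y \<in> loops" and n: "n \<in> loops" and w: "w \<in> carrier F"
    and flow: "flow \<Gamma> R w = flow \<Gamma> R y"
  shows "flow \<Gamma> R (n \<otimes>\<^bsub>F\<^esub> w \<otimes>\<^bsub>F\<^esub> inv\<^bsub>F\<^esub> n) = flow \<Gamma> R y"
proof -
  interpret L: subgroup loops F by (rule subgroup_loops)
  have w': "w \<in> loops" by (rule flow_determines_closing[OF y w flow])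
  have "wnet R (n \<otimes>\<^bsub>F\<^esub> w \<otimes>\<^bsub>F\<^esub> inv\<^bsub>F\<^esub> n) e = wnet R w e" for e
    using n w' by (simp add: wnet_loops_mult wnet_loops_inv)
  then show ?thesis using flow n w' y by (simp add: flow_eq_iff)
qed

lemma flow_mult_derived:
  assumes N: "N \<subseteq> loops" "c \<in> derived F N" and y: "y \<in> carrier F"
  shows "flow \<Gamma> R (c \<otimes>\<^bsub>F\<^esub> y) = flow \<Gamma> R y"
proof -
  have c: "c \<in> loops" using P.G.derived_incl[OF N(1) subgroup_loops] N(2) by blast
  then have "c \<in> carrier F" by (simp add: loops_def)
  then show ?thesis
    using c y wnet_derived[OF N] by (simp add: flow_eq_iff wnet_loops_mult)
qed

end

section \<open>Conjugacy in free solvable groups\<close>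

lemma group_hom_proj: "group_hom (free_group r) (free_solvable r i) (proj r i)"
proof -
  have "proj r i = (\<lambda>w. derived_term r i #>\<^bsub>free_group r\<^esub> w)"
    by (simp add: proj_def fun_eq_iff)
  then show ?thesis
    using normal.r_coset_hom_Mod[OF derived_term_normal, of r i] group_free_group group_free_solvable
    by (simp add: group_hom_def group_hom_axioms_def free_solvable_def)
qed

lemma proj_surj: "proj r i ` carrier (free_group r) = carrier (free_solvable r i)"
  by (auto simp: proj_def free_solvable_def FactGroup_def RCOSETS_def)

lemma proj_eq_iff:
  assumes v: "v \<in> carrier (free_group r)" and w: "w \<in> carrier (free_group r)"
  shows "proj r i v = proj r i w \<longleftrightarrow> v \<otimes>\<^bsub>free_group r\<^esub> inv\<^bsub>free_group r\<^esub> w \<in> derived_term r i"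
proof -
  interpret F: group "free_group r" by (rule group_free_group)
  interpret N: normal "derived_term r i" "free_group r" by (rule derived_term_normal)
  have "proj r i v = proj r i w \<longleftrightarrow> v \<in> proj r i w"
    using F.repr_independence[OF _ w N.subgroup_axioms] F.rcos_self[OF v N.subgroup_axioms]
    unfolding proj_def by blast
  then show ?thesis
    using N.rcos_module[OF F.group_axioms w v] by (simp add: proj_def)
qed

lemma coset_flow_Sch:
  assumes "y \<in> carrier (free_group r)"
  shows "coset_flow r (free_solvable r i) (proj r i) (Sch_root r i y)"
proof -
  have "subgroup (Sch_root r i y) (free_solvable r i)"
    unfolding Sch_root_def using assms
    by (intro group.generate_is_subgroup[OF group_free_solvable]) (auto intro: proj_closed)
  then show ?thesis
    by (intro coset_flow.intro coset_flow_axioms.intro group_hom_proj proj_surj)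
qed

lemma derived_term_Suc: "derived_term r (Suc i) = derived (free_group r) (derived_term r i)"
  by (simp add: derived_term_def)

text \<open>
  The loops of \<open>Sch r i y\<close> form the subgroup generated by \<open>y\<close> and \<open>derived_term r i\<close>: words that
  agree with a power of \<open>y\<close> modulo that term.
\<close>

lemma mem_loops_Sch:
  assumes y: "y \<in> carrier (free_group r)"
  shows "w \<in> coset_flow.loops r (proj r i) (Sch_root r i y) \<longleftrightarrow>
    w \<in> carrier (free_group r) \<and>
    (\<exists>k :: int. w \<otimes>\<^bsub>free_group r\<^esub> inv\<^bsub>free_group r\<^esub> (y [^]\<^bsub>free_group r\<^esub> k) \<in> derived_term r i)"
proof -
  interpret coset_flow r "free_solvable r i" "proj r i" "Sch_root r i y"
    by (rule coset_flow_Sch[OF y])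
  have "proj r i w \<in> Sch_root r i y \<longleftrightarrow> (\<exists>k :: int. proj r i w = proj r i (y [^]\<^bsub>F\<^esub> k))"
    using y by (auto simp: Sch_root_def P.H.generate_pow P.hom_int_pow)
  then show ?thesis using y by (auto simp: loops_def proj_eq_iff)
qed

lemma mem_loops_Sch_self:
  assumes y: "y \<in> carrier (free_group r)"
  shows "y \<in> coset_flow.loops r (proj r i) (Sch_root r i y)"
proof -
  interpret coset_flow r "free_solvable r i" "proj r i" "Sch_root r i y"
    by (rule coset_flow_Sch[OF y])
  have "proj r i y \<in> Sch_root r i y"
    unfolding Sch_root_def by (intro generate.incl) simp
  then show ?thesis using y by (simp add: loops_def)
qed

text \<open>
  Write \<open>N\<close> for \<open>derived_term r i\<close>. In the free solvable group of the next class, the image \<open>A\<close> of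
  \<open>N\<close> is abelian and normal, and the loops map into the subgroup \<open>L\<close> generated by \<open>A\<close> and the image
  \<open>t\<close> of \<open>y\<close>. Dividing \<open>L\<close> by the commutators of \<open>A\<close> with \<open>t\<close> gives a commutative group, in which \<open>w\<close>
  and \<open>y\<close> must have the same image. Thus \<open>w\<close> maps to \<open>(a t a\<inverse> t\<inverse>) t = a t a\<inverse>\<close> for some \<open>a\<close> in \<open>A\<close>.
\<close>

lemma conjugate_if_same_flow:
  assumes y: "y \<in> carrier (free_group r)" and w: "w \<in> carrier (free_group r)"
    and flow: "Sch_flow r i y w = Sch_flow r i y y"
  shows "\<exists>n\<in>derived_term r i. proj r (Suc i) w
    = proj r (Suc i) (n \<otimes>\<^bsub>free_group r\<^esub> y \<otimes>\<^bsub>free_group r\<^esub> inv\<^bsub>free_group r\<^esub> n)"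
proof -
  interpret coset_flow r "free_solvable r i" "proj r i" "Sch_root r i y"
    by (rule coset_flow_Sch[OF y])
  let ?N = "derived_term r i" and ?Q = "free_solvable r (Suc i)" and ?q = "proj r (Suc i)"
  interpret q: group_hom F ?Q ?q by (rule group_hom_proj)
  interpret N: normal ?N F by (rule derived_term_normal)
  let ?A = "?q ` ?N" and ?t = "?q y"
  have t: "?t \<in> carrier ?Q" using y by simp
  have A: "?A \<lhd> ?Q"
    using N.surj_hom_normal_subgroup[OF q.group_hom_axioms proj_surj] .
  have abelian: "a \<otimes>\<^bsub>?Q\<^esub> b = b \<otimes>\<^bsub>?Q\<^esub> a" if ab: "a \<in> ?A" "b \<in> ?A" for a b
  proof -
    obtain m n where mn: "m \<in> ?N" "n \<in> ?N" "a = ?q m" "b = ?q n" using ab by blast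
    have c: "m \<in> carrier F" "n \<in> carrier F" using mn(1,2) N.subset by blast+
    have "m \<otimes>\<^bsub>F\<^esub> n \<otimes>\<^bsub>F\<^esub> inv\<^bsub>F\<^esub> m \<otimes>\<^bsub>F\<^esub> inv\<^bsub>F\<^esub> n \<in> derived_term r (Suc i)"
      unfolding derived_term_Suc derived_def
      by (intro generate.incl UN_I[OF mn(1)] UN_I[OF mn(2)] singletonI)
    then have "(m \<otimes>\<^bsub>F\<^esub> n) \<otimes>\<^bsub>F\<^esub> inv\<^bsub>F\<^esub> (n \<otimes>\<^bsub>F\<^esub> m) \<in> derived_term r (Suc i)"
      using c by (simp add: P.G.inv_mult_group P.G.m_assoc)
    then have "?q (m \<otimes>\<^bsub>F\<^esub> n) = ?q (n \<otimes>\<^bsub>F\<^esub> m)" using c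
      by (simp add: proj_eq_iff del: q.hom_mult)
    then show ?thesis using mn c by simp
  qed
  define B where "B = generate ?Q (insert ?t ?A)"
  define L where "L = ?Q\<lparr>carrier := B\<rparr>"
  have A_sub: "?A \<subseteq> carrier ?Q" by auto
  have B: "subgroup B ?Q"
    unfolding B_def using t A_sub by (intro q.H.generate_is_subgroup) auto
  have gens: "insert ?t ?A \<subseteq> B" unfolding B_def by (blast intro: generate.incl)
  interpret L: group L unfolding L_def by (rule q.H.subgroup_imp_group[OF B])
  have L: "carrier L = B" "mult L = mult ?Q" by (simp_all add: L_def)
  have L_inv: "inv\<^bsub>L\<^esub> b = inv\<^bsub>?Q\<^esub> b" if "b \<in> B" for b
    unfolding L_def by (rule q.H.m_inv_consistent[OF B that])
  have A_L: "?A \<lhd> L"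
    unfolding L_def using q.H.normal_restrict_supergroup[OF B A] gens by blast
  have gen_L: "generate L (insert ?t ?A) = carrier L"
    unfolding L(1) using q.H.generate_consistent[OF gens B] by (simp add: L_def B_def)
  let ?C = "commutators_with L ?A ?t"
  have t_L: "?t \<in> carrier L" using gens by (simp add: L)
  have abelian_L: "a \<otimes>\<^bsub>L\<^esub> b = b \<otimes>\<^bsub>L\<^esub> a" if "a \<in> ?A" "b \<in> ?A" for a b
    unfolding L(2) by (rule abelian[OF that])
  interpret C: normal ?C L
    by (rule L.normal_commutators_with[OF A_L abelian_L t_L gen_L])
  have comm: "comm_group (L Mod ?C)"
    by (rule L.comm_group_Mod_commutators_with[OF A_L abelian_L t_L gen_L])
  have q_loops: "?q v \<in> B" if v: "v \<in> loops" for v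
  proof -
    obtain k :: int where k: "v \<otimes>\<^bsub>F\<^esub> inv\<^bsub>F\<^esub> (y [^]\<^bsub>F\<^esub> k) \<in> ?N" and vF: "v \<in> carrier F"
      using v unfolding mem_loops_Sch[OF y] by blast
    have "?q (v \<otimes>\<^bsub>F\<^esub> inv\<^bsub>F\<^esub> (y [^]\<^bsub>F\<^esub> k)) \<in> B" using k gens by blast
    moreover have "?t [^]\<^bsub>?Q\<^esub> k \<in> B"
      using q.H.subgroup_int_pow_closed[OF B] gens by blast
    ultimately have "?q (v \<otimes>\<^bsub>F\<^esub> inv\<^bsub>F\<^esub> (y [^]\<^bsub>F\<^esub> k)) \<otimes>\<^bsub>?Q\<^esub> ?t [^]\<^bsub>?Q\<^esub> k \<in> B"
      by (rule subgroup.m_closed[OF B])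
    then show ?thesis using vF y by (simp add: q.hom_int_pow[symmetric] q.H.m_assoc)
  qed
  have "(\<lambda>v. ?C #>\<^bsub>L\<^esub> ?q v) \<in> hom (F\<lparr>carrier := loops\<rparr>) (L Mod ?C)"
  proof (rule homI)
    fix u v assume uv: "u \<in> carrier (F\<lparr>carrier := loops\<rparr>)" "v \<in> carrier (F\<lparr>carrier := loops\<rparr>)"
    then have "?q u \<in> carrier L" "?q v \<in> carrier L" using q_loops by (auto simp: L)
    moreover have "u \<in> carrier F" "v \<in> carrier F" using uv by (auto simp: loops_def)
    ultimately show "?C #>\<^bsub>L\<^esub> ?q (u \<otimes>\<^bsub>F\<lparr>carrier := loops\<rparr>\<^esub> v)
        = (?C #>\<^bsub>L\<^esub> ?q u) \<otimes>\<^bsub>L Mod ?C\<^esub> (?C #>\<^bsub>L\<^esub> ?q v)"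
      using C.rcos_sum by (simp add: FactGroup_def L(2))
  qed (use q_loops in \<open>auto simp: FactGroup_def RCOSETS_def L(1)\<close>)
  moreover have y_loops: "y \<in> loops" by (rule mem_loops_Sch_self[OF y])
  moreover have "flow \<Gamma> (Sch_root r i y) w = flow \<Gamma> (Sch_root r i y) y"
    using flow by (simp add: Sch_flow_def Sch_def)
  moreover from this have w_loops: "w \<in> loops"
    using flow_determines_closing y_loops w by blast
  ultimately have "?C #>\<^bsub>L\<^esub> ?q w = ?C #>\<^bsub>L\<^esub> ?t"
    using flow_determines_abelian_image[OF comm] by blast
  then have "?q w \<in> ?C #>\<^bsub>L\<^esub> ?t"
    using L.rcos_self[OF _ C.subgroup_axioms, of "?q w"] q_loops[OF w_loops] by (simp add: L(1))
  then obtain n where n: "n \<in> ?N"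
    and qw: "?q w = ?q n \<otimes>\<^bsub>L\<^esub> ?t \<otimes>\<^bsub>L\<^esub> inv\<^bsub>L\<^esub> ?q n \<otimes>\<^bsub>L\<^esub> inv\<^bsub>L\<^esub> ?t \<otimes>\<^bsub>L\<^esub> ?t"
    unfolding r_coset_def commutators_with_def by blast
  have nB: "?q n \<in> B" "?t \<in> B" using gens n by auto
  have nF: "n \<in> carrier F" using n by simp
  have "?q w = ?q n \<otimes>\<^bsub>?Q\<^esub> ?t \<otimes>\<^bsub>?Q\<^esub> inv\<^bsub>?Q\<^esub> ?q n"
    using qw nF y by (simp add: L(2) L_inv[OF nB(1)] L_inv[OF nB(2)] q.H.m_assoc)
  then show ?thesis using n nF y by (intro bexI[of _ n]) simp_all
qed

text \<open>
  Here \<open>w y\<inverse>\<close> is a product of commutators of elements of \<open>derived_term r i\<close>. These elements are loops,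
  so the flow of \<open>w y\<inverse>\<close> is zero.
\<close>

lemma same_flow_if_proj_eq:
  assumes y: "y \<in> carrier (free_group r)" and w: "w \<in> carrier (free_group r)"
    and eq: "proj r (Suc i) w = proj r (Suc i) y"
  shows "Sch_flow r i y w = Sch_flow r i y y"
proof -
  interpret coset_flow r "free_solvable r i" "proj r i" "Sch_root r i y"
    by (rule coset_flow_Sch[OF y])
  interpret N: normal "derived_term r i" F by (rule derived_term_normal)
  have N: "derived_term r i \<subseteq> loops"
    unfolding subset_iff mem_loops_Sch[OF y] by (auto intro!: exI[of _ "0 :: int"])
  have "w \<otimes>\<^bsub>F\<^esub> inv\<^bsub>F\<^esub> y \<in> derived F (derived_term r i)"
    using eq y w by (simp add: proj_eq_iff derived_term_Suc)
  from flow_mult_derived[OF N this y] show ?thesis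
    using y w by (simp add: Sch_flow_def Sch_def P.G.m_assoc)
qed

text \<open>
  Changing \<open>z\<close> within its class modulo \<open>derived_term r i\<close> conjugates \<open>z x z\<inverse>\<close> by a loop.
\<close>

lemma same_flow_depends_on_proj:
  assumes x: "x \<in> carrier (free_group r)" and y: "y \<in> carrier (free_group r)"
    and z: "z \<in> carrier (free_group r)" and z': "z' \<in> carrier (free_group r)"
    and eq: "proj r i z = proj r i z'"
    and flow: "Sch_flow r i y (z \<otimes>\<^bsub>free_group r\<^esub> x \<otimes>\<^bsub>free_group r\<^esub> inv\<^bsub>free_group r\<^esub> z)
      = Sch_flow r i y y"
  shows "Sch_flow r i y (z' \<otimes>\<^bsub>free_group r\<^esub> x \<otimes>\<^bsub>free_group r\<^esub> inv\<^bsub>free_group r\<^esub> z')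
      = Sch_flow r i y y"
proof -
  interpret coset_flow r "free_solvable r i" "proj r i" "Sch_root r i y"
    by (rule coset_flow_Sch[OF y])
  define n where "n = z' \<otimes>\<^bsub>F\<^esub> inv\<^bsub>F\<^esub> z"
  have nF: "n \<in> carrier F" using z z' by (simp add: n_def)
  have "n \<in> derived_term r i" using eq proj_eq_iff[OF z' z, of i] by (simp add: n_def)
  then have n: "n \<in> loops"
    unfolding mem_loops_Sch[OF y] using nF by (auto intro!: exI[of _ "0 :: int"])
  have y_loops: "y \<in> loops" by (rule mem_loops_Sch_self[OF y])
  have "n \<otimes>\<^bsub>F\<^esub> (z \<otimes>\<^bsub>F\<^esub> x \<otimes>\<^bsub>F\<^esub> inv\<^bsub>F\<^esub> z) \<otimes>\<^bsub>F\<^esub> inv\<^bsub>F\<^esub> n = z' \<otimes>\<^bsub>F\<^esub> x \<otimes>\<^bsub>F\<^esub> inv\<^bsub>F\<^esub> z'"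
    using x z z' by (simp add: n_def P.G.inv_mult_group P.G.m_assoc P.G.cancel_inverse_pair)
  then show ?thesis
    using flow_conj_loop[OF y_loops n, of "z \<otimes>\<^bsub>F\<^esub> x \<otimes>\<^bsub>F\<^esub> inv\<^bsub>F\<^esub> z"] flow x z
    by (simp add: Sch_flow_def Sch_def)
qed

theorem theorem6p4:
  fixes r d :: nat and x y :: word
  assumes "r \<ge> 1" and "d \<ge> 1"
    and "x \<in> carrier (free_group r)" and "y \<in> carrier (free_group r)"
  shows "(conjugate_in (free_solvable r d) (proj r d x) (proj r d y) \<longleftrightarrow>
      (\<exists>z\<in>carrier (free_group r).
        Sch_flow r (d - 1) y (z \<otimes>\<^bsub>free_group r\<^esub> x \<otimes>\<^bsub>free_group r\<^esub> inv\<^bsub>free_group r\<^esub> z)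
          = Sch_flow r (d - 1) y y)) \<and>
    (\<forall>z\<in>carrier (free_group r). \<forall>z'\<in>carrier (free_group r).
      proj r (d - 1) z = proj r (d - 1) z' \<longrightarrow>
        (Sch_flow r (d - 1) y (z \<otimes>\<^bsub>free_group r\<^esub> x \<otimes>\<^bsub>free_group r\<^esub> inv\<^bsub>free_group r\<^esub> z)
            = Sch_flow r (d - 1) y y \<longleftrightarrow>
         Sch_flow r (d - 1) y (z' \<otimes>\<^bsub>free_group r\<^esub> x \<otimes>\<^bsub>free_group r\<^esub> inv\<^bsub>free_group r\<^esub> z')
            = Sch_flow r (d - 1) y y))"
proof -
  note x = assms(3) and y = assms(4)
  have d: "Suc (d - 1) = d" using assms(2) by simp
  interpret q: group_hom "free_group r" "free_solvable r d" "proj r d" by (rule group_hom_proj)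
  let ?F = "free_group r" and ?Q = "free_solvable r d"
  let ?conj = "\<lambda>z. z \<otimes>\<^bsub>?F\<^esub> x \<otimes>\<^bsub>?F\<^esub> inv\<^bsub>?F\<^esub> z"
  have "conjugate_in ?Q (proj r d x) (proj r d y) \<longleftrightarrow>
    (\<exists>z\<in>carrier ?F. Sch_flow r (d - 1) y (?conj z) = Sch_flow r (d - 1) y y)"
  proof
    assume "conjugate_in ?Q (proj r d x) (proj r d y)"
    then obtain z where z: "z \<in> carrier ?F" "proj r d (?conj z) = proj r d y"
      using x unfolding conjugate_in_def proj_surj[symmetric] by auto
    then have "Sch_flow r (d - 1) y (?conj z) = Sch_flow r (d - 1) y y"
      using same_flow_if_proj_eq[OF y, of "?conj z" "d - 1"] x d by simp
    then show "\<exists>z\<in>carrier ?F. Sch_flow r (d - 1) y (?conj z) = Sch_flow r (d - 1) y y"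
      using z(1) by blast
  next
    assume "\<exists>z\<in>carrier ?F. Sch_flow r (d - 1) y (?conj z) = Sch_flow r (d - 1) y y"
    then obtain z where z: "z \<in> carrier ?F" "Sch_flow r (d - 1) y (?conj z) = Sch_flow r (d - 1) y y"
      by blast
    then obtain n where n: "n \<in> derived_term r (d - 1)"
      and eq: "proj r d (?conj z) = proj r d (n \<otimes>\<^bsub>?F\<^esub> y \<otimes>\<^bsub>?F\<^esub> inv\<^bsub>?F\<^esub> n)"
      using conjugate_if_same_flow[OF y _ z(2)] x d by auto
    have nF: "n \<in> carrier ?F"
      using n normal_imp_subgroup[OF derived_term_normal] subgroup.subset by blast
    (* z x z^-1 and n y n^-1 agree, so n^-1 z carries x to y. *)
    let ?g = "inv\<^bsub>?F\<^esub> n \<otimes>\<^bsub>?F\<^esub> z"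
    have g: "?g \<in> carrier ?F" using nF z(1) by simp
    have "proj r d (?conj ?g) = proj r d (inv\<^bsub>?F\<^esub> n \<otimes>\<^bsub>?F\<^esub> ?conj z \<otimes>\<^bsub>?F\<^esub> n)"
      using nF z(1) x by (simp add: q.G.inv_mult_group q.G.m_assoc del: q.hom_mult)
    also have "\<dots> = proj r d (inv\<^bsub>?F\<^esub> n \<otimes>\<^bsub>?F\<^esub> (n \<otimes>\<^bsub>?F\<^esub> y \<otimes>\<^bsub>?F\<^esub> inv\<^bsub>?F\<^esub> n) \<otimes>\<^bsub>?F\<^esub> n)"
      using eq nF z(1) x y q.hom_mult by (metis q.G.inv_closed q.G.m_closed)
    also have "\<dots> = proj r d y"
      using nF y by (simp add: q.G.m_assoc q.G.cancel_inverse_pair del: q.hom_mult)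
    finally show "conjugate_in ?Q (proj r d x) (proj r d y)"
      unfolding conjugate_in_def using g x by (intro bexI[of _ "proj r d ?g"]) auto
  qed
  then show ?thesis
    using same_flow_depends_on_proj[OF x y] by metis
qed

end
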